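(* Let $X$ be a Banach space, let $\alpha$ be a cross-norm on $X\odot X$, and let $\{x_k\}_{k\ge1}$ be a bounded sequence in $X$ such that the sequence $\{x_k\otimes x_k\}$ is weakly ergodic in $X\otimes_\alpha X$. Then $\{x_k\}$ is weakly mixing to zero.
   Context: $Z^*$ denotes the dual of a Banach space $Z$. $X\odot X$ is the algebraic tensor product; $X\otimes_\alpha X$ is its completion with respect to the cross-norm $\alpha$ (i.e. $\alpha(x\otimes y)=\|x\|\|y\|$). It is part of the setting that the conjugate (dual) norm $\alpha^*(\varphi)=\sup\{|\varphi(u)|:u\in X\odot X,\ \alpha(u)\le1\}$ on $X^*\odot X^*$ is a (finite) cross-norm, where $(f\otimes g)(x\otimes y)=f(x)g(y)$. A sequence $\{z_k\}_{k\ge1}$ in a Banach space $Z$ is weakly ergodic if $\lim_{n\to\infty}\frac1n|\sum_{k=1}^n f(z_k)|=0$ for all $f\in Z^*$; it is weakly mixing to zero if $\lim_{n\to\infty}\frac1n\sum_{k=1}^n|f(z_k)|=0$ for all $f\in Z^*$.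
   Formalization: The Banach space X (and its dual and tensor product) is taken over the real scalars; over the complex scalars the claim fails, e.g. X = C, x_k = e^{ikt} with 0 < t < pi, where x_k⊗x_k is weakly ergodic but |x_k| = 1. *)

theory Defs
  imports "HOL-Analysis.Analysis" "HOL-Library.Poly_Mapping"
begin

section \<open>The algebraic tensor product of real vector spaces\<close>

text \<open>The algebraic tensor product of \<open>'a\<close> and \<open>'b\<close> is the free real vector space
  on \<open>'a \<times> 'b\<close> (finitely supported functions) modulo the span of the bilinearity relations.\<close>

instantiation poly_mapping :: (type, real_vector) real_vector
begin

definition scaleR_poly_mapping :: "real \<Rightarrow> ('a \<Rightarrow>\<^sub>0 'b) \<Rightarrow> 'a \<Rightarrow>\<^sub>0 'b"
  where "scaleR_poly_mapping r p = Poly_Mapping.map (scaleR r) p"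

lemma lookup_scaleR:
  fixes p :: "'a \<Rightarrow>\<^sub>0 'b"
  shows "Poly_Mapping.lookup (r *\<^sub>R p) k = r *\<^sub>R Poly_Mapping.lookup p k"
  by (simp add: scaleR_poly_mapping_def map.rep_eq when_def)

instance
  by standard (rule poly_mapping_eqI;
      simp add: lookup_scaleR lookup_add scaleR_add_right scaleR_add_left)+

end

definition tensor_relations :: "('a::real_vector \<times> 'b::real_vector \<Rightarrow>\<^sub>0 real) set"
  where "tensor_relations =
    {Poly_Mapping.single (x + x', y) 1 - Poly_Mapping.single (x, y) 1
        - Poly_Mapping.single (x', y) 1 | x x' y. True} \<union>
    {Poly_Mapping.single (x, y + y') 1 - Poly_Mapping.single (x, y) 1
        - Poly_Mapping.single (x, y') 1 | x y y'. True} \<union>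
    {Poly_Mapping.single (r *\<^sub>R x, y) 1 - r *\<^sub>R Poly_Mapping.single (x, y) 1 | r x y. True} \<union>
    {Poly_Mapping.single (x, r *\<^sub>R y) 1 - r *\<^sub>R Poly_Mapping.single (x, y) 1 | r x y. True}"

definition tensor_eq ::
    "('a::real_vector \<times> 'b::real_vector \<Rightarrow>\<^sub>0 real) \<Rightarrow> ('a \<times> 'b \<Rightarrow>\<^sub>0 real) \<Rightarrow> bool"
  where "tensor_eq p q \<longleftrightarrow> p - q \<in> span tensor_relations"

lemma equivp_tensor_eq: "equivp tensor_eq"
proof (rule equivpI)
  show "reflp tensor_eq"
    by (auto simp: reflp_def tensor_eq_def span_zero)
  show "symp tensor_eq"
    unfolding symp_def tensor_eq_def by (auto dest: span_neg)
  show "transp tensor_eq"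
    unfolding transp_def tensor_eq_def by (auto dest: span_add)
qed

quotient_type (overloaded) ('a, 'b) tensor =
  "'a::real_vector \<times> 'b::real_vector \<Rightarrow>\<^sub>0 real" / tensor_eq
  by (rule equivp_tensor_eq)

instantiation tensor :: (real_vector, real_vector) real_vector
begin

lift_definition zero_tensor :: "('a, 'b) tensor" is 0 .

lift_definition plus_tensor :: "('a, 'b) tensor \<Rightarrow> ('a, 'b) tensor \<Rightarrow> ('a, 'b) tensor" is "(+)"
  unfolding tensor_eq_def add_diff_add by (rule span_add)

lift_definition uminus_tensor :: "('a, 'b) tensor \<Rightarrow> ('a, 'b) tensor" is uminus
  unfolding tensor_eq_def minus_diff_minus by (rule span_neg)

lift_definition minus_tensor :: "('a, 'b) tensor \<Rightarrow> ('a, 'b) tensor \<Rightarrow> ('a, 'b) tensor" is "(-)"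
proof -
  fix p p' q q' :: "'a \<times> 'b \<Rightarrow>\<^sub>0 real"
  assume "tensor_eq p p'" "tensor_eq q q'"
  moreover have "p - q - (p' - q') = (p - p') - (q - q')"
    by (simp add: algebra_simps)
  ultimately show "tensor_eq (p - q) (p' - q')"
    unfolding tensor_eq_def by (simp only: span_diff)
qed

lift_definition scaleR_tensor :: "real \<Rightarrow> ('a, 'b) tensor \<Rightarrow> ('a, 'b) tensor" is "scaleR"
  unfolding tensor_eq_def scaleR_diff_right[symmetric] by (rule span_scale)

instance
proof
  fix a b c :: "('a, 'b) tensor" and r s :: real
  have refl: "tensor_eq p p" for p :: "'a \<times> 'b \<Rightarrow>\<^sub>0 real"
    by (simp add: tensor_eq_def span_zero)
  show "a + b + c = a + (b + c)" by transfer (simp add: refl add.assoc)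
  show "a + b = b + a" by transfer (simp add: refl add.commute)
  show "0 + a = a" by transfer (simp add: refl)
  show "- a + a = 0" by transfer (simp add: refl)
  show "a - b = a + - b" by transfer (simp add: refl)
  show "r *\<^sub>R (a + b) = r *\<^sub>R a + r *\<^sub>R b" by transfer (simp add: refl scaleR_add_right)
  show "(r + s) *\<^sub>R a = r *\<^sub>R a + s *\<^sub>R a" by transfer (simp add: refl scaleR_add_left)
  show "r *\<^sub>R s *\<^sub>R a = (r * s) *\<^sub>R a" by transfer (simp add: refl)
  show "1 *\<^sub>R a = a" by transfer (simp add: refl)
qed

end

lift_definition tensor_prod ::
    "'a::real_vector \<Rightarrow> 'b::real_vector \<Rightarrow> ('a, 'b) tensor"  (infixr "\<otimes>" 75)
  is "\<lambda>x y. Poly_Mapping.single (x, y) 1" .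

definition free_lift :: "('a \<Rightarrow> 'b \<Rightarrow> 'c) \<Rightarrow> ('a \<times> 'b \<Rightarrow>\<^sub>0 real) \<Rightarrow> 'c::real_vector"
  where "free_lift B p =
    (\<Sum>k\<in>Poly_Mapping.keys p. Poly_Mapping.lookup p k *\<^sub>R B (fst k) (snd k))"

text \<open>The linear map induced by a bilinear map \<open>B\<close>. For bilinear \<open>B\<close> the value does not depend on
  the representative (see \<open>linear_tensor_lift\<close> and \<open>tensor_lift_prod\<close> below); for other \<open>B\<close> it is
  meaningless.\<close>

definition tensor_lift ::
    "('a::real_vector \<Rightarrow> 'b::real_vector \<Rightarrow> 'c::real_vector) \<Rightarrow> ('a, 'b) tensor \<Rightarrow> 'c"
  where "tensor_lift B u = free_lift B (rep_tensor u)"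

lemma free_lift_superset:
  assumes "finite A" "Poly_Mapping.keys p \<subseteq> A"
  shows "free_lift B p = (\<Sum>k\<in>A. Poly_Mapping.lookup p k *\<^sub>R B (fst k) (snd k))"
  unfolding free_lift_def
  by (rule sum.mono_neutral_left) (use assms in \<open>auto simp: in_keys_iff\<close>)

lemma linear_free_lift: "linear (free_lift B)"
proof (rule linearI)
  fix p q :: "'a \<times> 'b \<Rightarrow>\<^sub>0 real" and r :: real
  let ?A = "Poly_Mapping.keys p \<union> Poly_Mapping.keys q"
  have "free_lift B (p + q) =
      (\<Sum>k\<in>?A. Poly_Mapping.lookup (p + q) k *\<^sub>R B (fst k) (snd k))"
    by (rule free_lift_superset) (simp_all add: keys_add)
  also have "\<dots> = free_lift B p + free_lift B q"
    by (simp add: free_lift_superset[of ?A p] free_lift_superset[of ?A q]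
        lookup_add scaleR_add_left sum.distrib)
  finally show "free_lift B (p + q) = free_lift B p + free_lift B q" .
  have "Poly_Mapping.keys (r *\<^sub>R p) \<subseteq> Poly_Mapping.keys p"
    by (auto simp: in_keys_iff lookup_scaleR)
  then have "free_lift B (r *\<^sub>R p) =
      (\<Sum>k\<in>Poly_Mapping.keys p. Poly_Mapping.lookup (r *\<^sub>R p) k *\<^sub>R B (fst k) (snd k))"
    by (intro free_lift_superset) simp_all
  then show "free_lift B (r *\<^sub>R p) = r *\<^sub>R free_lift B p"
    by (simp add: free_lift_def lookup_scaleR scaleR_sum_right)
qed

lemma free_lift_single: "free_lift B (Poly_Mapping.single (x, y) 1) = B x y"
  by (simp add: free_lift_def)

lemma free_lift_cong:
  assumes "bilinear B" "tensor_eq p q"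
  shows "free_lift B p = free_lift B q"
proof -
  have "free_lift B t = 0" if "t \<in> tensor_relations" for t
    using that assms(1) unfolding tensor_relations_def
    by (auto simp: linear_diff[OF linear_free_lift] linear_scale[OF linear_free_lift]
        free_lift_single bilinear_ladd bilinear_radd bilinear_lmul bilinear_rmul)
  then have "free_lift B t = 0" if "t \<in> span tensor_relations" for t
    using linear_eq_0_on_span[OF linear_free_lift _ that] by blast
  then show ?thesis
    using assms(2) linear_diff[OF linear_free_lift, of B p q] by (simp add: tensor_eq_def)
qed

lemma tensor_lift_abs:
  assumes "bilinear B"
  shows "tensor_lift B (abs_tensor p) = free_lift B p"
  unfolding tensor_lift_def
  by (rule free_lift_cong[OF assms])
    (rule Quotient3_rep_abs[OF Quotient3_tensor equivp_reflp[OF equivp_tensor_eq]])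

lemma linear_tensor_lift:
  assumes "bilinear B"
  shows "linear (tensor_lift B)"
proof (rule linearI)
  fix u v :: "('a, 'b) tensor" and r :: real
  obtain p q where "u = abs_tensor p" "v = abs_tensor q"
    by (metis Quotient3_abs_rep[OF Quotient3_tensor])
  then show "tensor_lift B (u + v) = tensor_lift B u + tensor_lift B v"
    and "tensor_lift B (r *\<^sub>R u) = r *\<^sub>R tensor_lift B u"
    by (simp_all add: plus_tensor.abs_eq scaleR_tensor.abs_eq tensor_lift_abs[OF assms]
        linear_add[OF linear_free_lift] linear_scale[OF linear_free_lift])
qed

lemma tensor_lift_prod:
  assumes "bilinear B"
  shows "tensor_lift B (x \<otimes> y) = B x y"
  by (simp add: tensor_prod.abs_eq tensor_lift_abs[OF assms] free_lift_single)

lemma bilinear_tensor_prod: "bilinear (\<otimes>)"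
proof -
  have "(x + x') \<otimes> y = x \<otimes> y + x' \<otimes> y" for x x' :: 'a and y :: 'b
    by transfer (unfold tensor_eq_def diff_diff_eq[symmetric],
        rule span_base, unfold tensor_relations_def, blast)
  moreover have "x \<otimes> (y + y') = x \<otimes> y + x \<otimes> y'" for x :: 'a and y y' :: 'b
    by transfer (unfold tensor_eq_def diff_diff_eq[symmetric],
        rule span_base, unfold tensor_relations_def, blast)
  moreover have "(r *\<^sub>R x) \<otimes> y = r *\<^sub>R (x \<otimes> y)" for r and x :: 'a and y :: 'b
    by transfer (unfold tensor_eq_def, rule span_base, unfold tensor_relations_def, blast)
  moreover have "x \<otimes> (r *\<^sub>R y) = r *\<^sub>R (x \<otimes> y)" for r and x :: 'a and y :: 'b
    by transfer (unfold tensor_eq_def, rule span_base, unfold tensor_relations_def, blast)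
  ultimately show ?thesis
    unfolding bilinear_def by (auto intro!: linearI)
qed

section \<open>Cross-norms and their conjugates\<close>

definition is_norm :: "('v::real_vector \<Rightarrow> real) \<Rightarrow> bool"
  where "is_norm \<nu> \<longleftrightarrow>
    (\<forall>u. 0 \<le> \<nu> u) \<and>
    (\<forall>u. \<nu> u = 0 \<longleftrightarrow> u = 0) \<and>
    (\<forall>r u. \<nu> (r *\<^sub>R u) = \<bar>r\<bar> * \<nu> u) \<and>
    (\<forall>u v. \<nu> (u + v) \<le> \<nu> u + \<nu> v)"

definition cross_norm :: "(('a::real_normed_vector, 'b::real_normed_vector) tensor \<Rightarrow> real) \<Rightarrow> bool"
  where "cross_norm \<alpha> \<longleftrightarrow> is_norm \<alpha> \<and> (\<forall>x y. \<alpha> (x \<otimes> y) = norm x * norm y)"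

text \<open>The action of \<open>X\<^sup>* \<odot> X\<^sup>*\<close> on \<open>X \<odot> X\<close>, determined by
  \<open>(f \<otimes> g) (x \<otimes> y) = f x * g y\<close>.\<close>

definition functional_tensor ::
    "('a::real_normed_vector \<Rightarrow>\<^sub>L real) \<Rightarrow> ('b::real_normed_vector \<Rightarrow>\<^sub>L real) \<Rightarrow> ('a, 'b) tensor \<Rightarrow> real"
  where "functional_tensor f g = tensor_lift (\<lambda>x y. blinfun_apply f x * blinfun_apply g y)"

definition tensor_apply ::
    "('a::real_normed_vector \<Rightarrow>\<^sub>L real, 'b::real_normed_vector \<Rightarrow>\<^sub>L real) tensor
      \<Rightarrow> ('a, 'b) tensor \<Rightarrow> real"
  where "tensor_apply \<phi> u = tensor_lift (\<lambda>f g. functional_tensor f g u) \<phi>"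

lemma tensor_induct:
  fixes u :: "('a::real_vector, 'b::real_vector) tensor"
  assumes "\<And>x y. P (x \<otimes> y)" "\<And>u v. P u \<Longrightarrow> P v \<Longrightarrow> P (u + v)" "\<And>r u. P u \<Longrightarrow> P (r *\<^sub>R u)"
  shows "P u"
proof -
  have *: "P (abs_tensor (Poly_Mapping.single k c))" for k c
  proof -
    have "Poly_Mapping.single k c = c *\<^sub>R Poly_Mapping.single k (1::real)"
      by (rule poly_mapping_eqI) (simp add: lookup_scaleR lookup_single when_def)
    then have "abs_tensor (Poly_Mapping.single k c) = c *\<^sub>R (fst k \<otimes> snd k)"
      by (simp add: scaleR_tensor.abs_eq tensor_prod.abs_eq)
    then show ?thesis using assms by simp
  qed
  have "P (abs_tensor p)" for p
  proof (induction p rule: update_induct)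
    case const
    show ?case
      using assms(3)[OF assms(1), of 0 0 0] by (simp add: zero_tensor.abs_eq[symmetric])
  next
    case (update p k c)
    have "Poly_Mapping.update k c p = p + Poly_Mapping.single k c"
      using update(1)
      by (intro poly_mapping_eqI) (auto simp: lookup_update lookup_add lookup_single in_keys_iff)
    then show ?case using update(3) * assms(2) by (simp flip: plus_tensor.abs_eq)
  qed
  from this[of "rep_tensor u"] show ?thesis
    by (simp add: Quotient3_abs_rep[OF Quotient3_tensor])
qed

lemma bilinear_blinfun_mult:
  "bilinear (\<lambda>x y. blinfun_apply f x * (blinfun_apply g y :: real))"
  unfolding bilinear_def
  by (auto intro!: linearI simp: blinfun.add_right blinfun.scaleR_right distrib_left distrib_right)

lemma linear_functional_tensor: "linear (functional_tensor f g)"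
  unfolding functional_tensor_def by (rule linear_tensor_lift[OF bilinear_blinfun_mult])

lemma functional_tensor_prod:
  "functional_tensor f g (x \<otimes> y) = blinfun_apply f x * blinfun_apply g y"
  unfolding functional_tensor_def by (rule tensor_lift_prod[OF bilinear_blinfun_mult])

lemma bilinear_functional_tensor: "bilinear (\<lambda>f g. functional_tensor f g u)"
proof -
  note simps = linear_add[OF linear_functional_tensor] linear_scale[OF linear_functional_tensor]
    functional_tensor_prod blinfun.add_left blinfun.scaleR_left distrib_left distrib_right
  have "functional_tensor (f + f') g u = functional_tensor f g u + functional_tensor f' g u"
    for f f' g
    by (induction u rule: tensor_induct) (simp_all add: simps)
  moreover have "functional_tensor f (g + g') u = functional_tensor f g u + functional_tensor f g' u"
    for f g g'
    by (induction u rule: tensor_induct) (simp_all add: simps)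
  moreover have "functional_tensor (r *\<^sub>R f) g u = r *\<^sub>R functional_tensor f g u" for r f g
    by (induction u rule: tensor_induct) (simp_all add: simps)
  moreover have "functional_tensor f (r *\<^sub>R g) u = r *\<^sub>R functional_tensor f g u" for r f g
    by (induction u rule: tensor_induct) (simp_all add: simps)
  ultimately show ?thesis
    unfolding bilinear_def by (auto intro!: linearI)
qed

lemma tensor_apply_functional: "tensor_apply (f \<otimes> g) u = functional_tensor f g u"
  unfolding tensor_apply_def by (rule tensor_lift_prod[OF bilinear_functional_tensor])

lemma tensor_apply_prod:
  "tensor_apply (f \<otimes> g) (x \<otimes> y) = blinfun_apply f x * blinfun_apply g y"
  by (simp add: tensor_apply_functional functional_tensor_prod)

lemma bilinear_tensor_apply: "bilinear tensor_apply"
proof -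
  have l: "linear (\<lambda>\<phi>. tensor_apply \<phi> u)"
    for u :: "('a::real_normed_vector, 'b::real_normed_vector) tensor"
    unfolding tensor_apply_def by (rule linear_tensor_lift[OF bilinear_functional_tensor])
  note simps = tensor_apply_functional linear_add[OF l] linear_scale[OF l]
    linear_add[OF linear_functional_tensor] linear_scale[OF linear_functional_tensor]
  have "tensor_apply \<phi> (u + v) = tensor_apply \<phi> u + tensor_apply \<phi> v"
    for \<phi> and u v :: "('a, 'b) tensor"
    by (induction \<phi> rule: tensor_induct) (simp_all add: simps distrib_left)
  moreover have "tensor_apply \<phi> (r *\<^sub>R u) = r *\<^sub>R tensor_apply \<phi> u"
    for r \<phi> and u :: "('a, 'b) tensor"
    by (induction \<phi> rule: tensor_induct) (simp_all add: simps distrib_left)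
  ultimately show ?thesis
    using l unfolding bilinear_def by (auto intro!: linearI)
qed

definition conjugate_norm ::
    "(('a::real_normed_vector, 'b::real_normed_vector) tensor \<Rightarrow> real)
      \<Rightarrow> ('a \<Rightarrow>\<^sub>L real, 'b \<Rightarrow>\<^sub>L real) tensor \<Rightarrow> real"
  where "conjugate_norm \<alpha> \<phi> = (SUP u\<in>{u. \<alpha> u \<le> 1}. \<bar>tensor_apply \<phi> u\<bar>)"

text \<open>\<^const>\<open>conjugate_norm\<close> is a real supremum, so its finiteness has to be required separately.\<close>

definition conjugate_norm_finite ::
    "(('a::real_normed_vector, 'b::real_normed_vector) tensor \<Rightarrow> real) \<Rightarrow> bool"
  where "conjugate_norm_finite \<alpha> \<longleftrightarrow>
    (\<forall>\<phi>. bdd_above ((\<lambda>u. \<bar>tensor_apply \<phi> u\<bar>) ` {u. \<alpha> u \<le> 1}))"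

text \<open>A completion of \<open>('v, \<nu>)\<close>: a Banach space containing it isometrically as a dense subspace,
  which determines it up to isometric isomorphism. It is given by the embedding \<open>\<iota>\<close>, since a
  type cannot depend on the norm \<open>\<nu>\<close>.\<close>

definition is_completion :: "('v::real_vector \<Rightarrow> real) \<Rightarrow> ('v \<Rightarrow> 'z::banach) \<Rightarrow> bool"
  where "is_completion \<nu> \<iota> \<longleftrightarrow>
    linear \<iota> \<and> (\<forall>u. norm (\<iota> u) = \<nu> u) \<and> closure (range \<iota>) = UNIV"

section \<open>Ergodicity and mixing of sequences\<close>

text \<open>Sequences are indexed from 1; the value at 0 is irrelevant.\<close>

definition weakly_ergodic :: "(nat \<Rightarrow> 'z::banach) \<Rightarrow> bool"
  where "weakly_ergodic z \<longleftrightarrow>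
    (\<forall>f :: 'z \<Rightarrow>\<^sub>L real. (\<lambda>n. 1 / real n * \<bar>\<Sum>k=1..n. blinfun_apply f (z k)\<bar>) \<longlonglongrightarrow> 0)"

definition weakly_mixing_to_zero :: "(nat \<Rightarrow> 'z::banach) \<Rightarrow> bool"
  where "weakly_mixing_to_zero z \<longleftrightarrow>
    (\<forall>f :: 'z \<Rightarrow>\<^sub>L real. (\<lambda>n. 1 / real n * (\<Sum>k=1..n. \<bar>blinfun_apply f (z k)\<bar>)) \<longlonglongrightarrow> 0)"

end

theory Submission
  imports Defs
begin

text \<open>Since the conjugate norm of \<open>f \<otimes> f\<close> is finite, \<open>f \<otimes> f\<close> extends to a bounded functional on the
  completion. Weak ergodicity of \<open>x k \<otimes> x k\<close> tested against it says that the averages of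
  \<open>(f (x k))\<^sup>2\<close> tend to zero, and by the Cauchy--Schwarz inequality so do those of \<open>\<bar>f (x k)\<bar>\<close>.\<close>

text \<open>The bound makes \<open>\<phi>\<close> factor through \<open>range \<iota>\<close> as a
  Lipschitz map. Completeness of the target extends this map to the closure, and density makes the
  closure the whole space.\<close>

lemma bounded_functional_extension:
  fixes \<iota> :: "'v::real_vector \<Rightarrow> 'z::real_normed_vector" and \<phi> :: "'v \<Rightarrow> 'c::banach"
  assumes \<iota>: "linear \<iota>" and \<phi>: "linear \<phi>"
    and bound: "\<And>u. norm (\<phi> u) \<le> C * norm (\<iota> u)"
    and dense: "closure (range \<iota>) = UNIV"
  shows "\<exists>F :: 'z \<Rightarrow>\<^sub>L 'c. \<forall>u. blinfun_apply F (\<iota> u) = \<phi> u"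
proof -
  \<comment> \<open>\<open>inv \<iota>\<close> only picks some preimage, as \<open>\<iota>\<close>
    is not assumed injective. The choice is harmless: by \<open>diff\<close>, two preimages of one
    point have the same image under \<open>\<phi>\<close>.\<close>
  define g where "g z = \<phi> (inv \<iota> z)" for z
  have diff: "norm (\<phi> u - \<phi> v) \<le> C * norm (\<iota> u - \<iota> v)" for u v
    using bound[of "u - v"] by (simp add: linear_diff[OF \<iota>] linear_diff[OF \<phi>])
  have g: "g (\<iota> u) = \<phi> u" for u
    using diff[of "inv \<iota> (\<iota> u)" u] by (simp add: g_def f_inv_into_f)
  \<comment> \<open>A Lipschitz constant must be nonnegative, while the sign of \<open>C\<close> is
    unspecified; hence the absolute value.\<close>
  have "\<bar>C\<bar>-lipschitz_on (range \<iota>) g"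
  proof (rule lipschitz_onI)
    fix y z assume "y \<in> range \<iota>" "z \<in> range \<iota>"
    then obtain u v where uv: "y = \<iota> u" "z = \<iota> v" by blast
    have "norm (\<phi> u - \<phi> v) \<le> \<bar>C\<bar> * norm (\<iota> u - \<iota> v)"
      by (rule order_trans[OF diff]) (simp add: mult_right_mono)
    then show "dist (g y) (g z) \<le> \<bar>C\<bar> * dist y z"
      by (simp add: uv g dist_norm)
  qed simp
  then have "uniformly_continuous_on (range \<iota>) g"
    by (rule lipschitz_on_uniformly_continuous)
  then obtain F where "uniformly_continuous_on (closure (range \<iota>)) F"
    and "\<And>z. z \<in> range \<iota> \<Longrightarrow> g z = F z"
    by (rule uniformly_continuous_on_extension_on_closure) blast
  then have F: "F (\<iota> u) = \<phi> u" and cont: "continuous_on UNIV F" for u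
    using dense uniformly_continuous_imp_continuous g by (metis rangeI, metis)
  have lim: "(\<lambda>n. F (s n)) \<longlonglongrightarrow> F z" if "s \<longlonglongrightarrow> z" for s z
    using continuous_on_tendsto_compose[OF cont that] by simp
  have approx: "\<exists>u. (\<lambda>n. \<iota> (u n)) \<longlonglongrightarrow> z" for z
  proof -
    have "z \<in> closure (range \<iota>)" using dense by simp
    then obtain s where "\<And>n. s n \<in> range \<iota>" and s: "s \<longlonglongrightarrow> z"
      unfolding closure_sequential by blast
    then have "(\<lambda>n. \<iota> (inv \<iota> (s n))) = s" by (auto simp: f_inv_into_f)
    then show ?thesis using s by (intro exI[of _ "\<lambda>n. inv \<iota> (s n)"]) simp
  qed
  \<comment> \<open>Additivity, homogeneity and the norm bound hold on \<open>range \<iota>\<close>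
    and pass to limits along the sequences from \<open>approx\<close>.\<close>
  have "bounded_linear F"
  proof (rule bounded_linear_intro)
    fix y z
    obtain u v where u: "(\<lambda>n. \<iota> (u n)) \<longlonglongrightarrow> y" and v: "(\<lambda>n. \<iota> (v n)) \<longlonglongrightarrow> z"
      using approx by meson
    have "(\<lambda>n. F (\<iota> (u n + v n))) \<longlonglongrightarrow> F (y + z)"
      unfolding linear_add[OF \<iota>] by (intro lim tendsto_add u v)
    moreover have "(\<lambda>n. F (\<iota> (u n + v n))) \<longlonglongrightarrow> F y + F z"
      using tendsto_add[OF lim[OF u] lim[OF v]] by (simp add: F linear_add[OF \<phi>])
    ultimately show "F (y + z) = F y + F z" by (rule LIMSEQ_unique)
  next
    fix r z
    obtain u where u: "(\<lambda>n. \<iota> (u n)) \<longlonglongrightarrow> z" using approx by meson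
    have "(\<lambda>n. F (\<iota> (r *\<^sub>R u n))) \<longlonglongrightarrow> F (r *\<^sub>R z)"
      unfolding linear_scale[OF \<iota>] by (intro lim tendsto_scaleR tendsto_const u)
    moreover have "(\<lambda>n. F (\<iota> (r *\<^sub>R u n))) \<longlonglongrightarrow> r *\<^sub>R F z"
      using tendsto_scaleR[OF tendsto_const lim[OF u], of r] by (simp add: F linear_scale[OF \<phi>])
    ultimately show "F (r *\<^sub>R z) = r *\<^sub>R F z" by (rule LIMSEQ_unique)
  next
    fix z
    obtain u where u: "(\<lambda>n. \<iota> (u n)) \<longlonglongrightarrow> z" using approx by meson
    have "norm (F z) \<le> C * norm z"
      by (rule LIMSEQ_le[OF tendsto_norm[OF lim[OF u]] tendsto_mult[OF tendsto_const tendsto_norm[OF u]]])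
        (simp add: F bound)
    then show "norm (F z) \<le> norm z * C" by (simp add: mult.commute)
  qed
  then show ?thesis
    using F by (intro exI[of _ "Blinfun F"]) (simp add: bounded_linear_Blinfun_apply)
qed

text \<open>Rescaling a nonzero \<open>u\<close> to \<open>\<alpha>\<close>-norm one brings it into
  the set over which the supremum is taken. Finiteness guarantees that this real supremum is an
  upper bound.\<close>

lemma conjugate_norm_bound:
  assumes "is_norm \<alpha>" and "conjugate_norm_finite \<alpha>"
  shows "\<bar>tensor_apply \<phi> u\<bar> \<le> conjugate_norm \<alpha> \<phi> * \<alpha> u"
proof -
  have lin: "linear (tensor_apply \<phi>)"
    using bilinear_tensor_apply unfolding bilinear_def by blast
  show ?thesis
  proof (cases "u = 0")
    case True
    moreover have "\<alpha> 0 = 0" using assms(1) by (simp add: is_norm_def)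
    ultimately show ?thesis by (simp add: linear_0[OF lin])
  next
    case False
    then have pos: "0 < \<alpha> u"
      using assms(1) unfolding is_norm_def by (metis less_eq_real_def)
    have "\<alpha> ((1 / \<alpha> u) *\<^sub>R u) = \<bar>1 / \<alpha> u\<bar> * \<alpha> u"
      using assms(1) unfolding is_norm_def by blast
    then have "\<alpha> ((1 / \<alpha> u) *\<^sub>R u) \<le> 1" using pos by simp
    then have "\<bar>tensor_apply \<phi> ((1 / \<alpha> u) *\<^sub>R u)\<bar> \<le> conjugate_norm \<alpha> \<phi>"
      using assms(2) unfolding conjugate_norm_def conjugate_norm_finite_def
      by (intro cSUP_upper) auto
    then show ?thesis
      using pos by (simp add: linear_scale[OF lin] abs_mult field_simps)
  qed
qed

text \<open>By Cauchy-Schwarz, the mean of the absolute values is at most the square root of the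
  mean of the squares.\<close>

lemma cesaro_abs_tendsto_zero_if_square:
  fixes a :: "nat \<Rightarrow> real"
  assumes "(\<lambda>n. 1 / real n * (\<Sum>k=1..n. (a k)\<^sup>2)) \<longlonglongrightarrow> 0"
  shows "(\<lambda>n. 1 / real n * (\<Sum>k=1..n. \<bar>a k\<bar>)) \<longlonglongrightarrow> 0"
proof (rule tendsto_sandwich[OF _ _ tendsto_const])
  show "(\<lambda>n. sqrt (1 / real n * (\<Sum>k=1..n. (a k)\<^sup>2))) \<longlonglongrightarrow> 0"
    using tendsto_real_sqrt[OF assms] by simp
  show "\<forall>\<^sub>F n in sequentially. 1 / real n * (\<Sum>k=1..n. \<bar>a k\<bar>)
      \<le> sqrt (1 / real n * (\<Sum>k=1..n. (a k)\<^sup>2))"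
  proof (rule always_eventually, rule allI, rule real_le_rsqrt)
    fix n
    have "(\<Sum>k=1..n. \<bar>a k\<bar>)\<^sup>2 \<le> real n * (\<Sum>k=1..n. (a k)\<^sup>2)"
      using sum_squared_le_sum_of_squares[of "\<lambda>k. \<bar>a k\<bar>" "{1..n}"] by (simp add: mult.commute)
    then show "(1 / real n * (\<Sum>k=1..n. \<bar>a k\<bar>))\<^sup>2 \<le> 1 / real n * (\<Sum>k=1..n. (a k)\<^sup>2)"
      \<comment> \<open>For \<open>n = 0\<close> both sides vanish; otherwise divide the previous
        inequality by the square of \<open>n\<close>.\<close>
      by (cases "n = 0") (simp_all add: power_mult_distrib power2_eq_square field_simps)
  qed
qed (simp add: sum_nonneg)

theorem proposition2p6:
  fixes \<alpha> :: "('a::banach, 'a) tensor \<Rightarrow> real"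
    and \<iota> :: "('a, 'a) tensor \<Rightarrow> 'z::banach"
    and x :: "nat \<Rightarrow> 'a"
  assumes "cross_norm \<alpha>"
    and "conjugate_norm_finite \<alpha>" and "cross_norm (conjugate_norm \<alpha>)"
    and "is_completion \<alpha> \<iota>"
    and "bounded (x ` {1..})"
    and "weakly_ergodic (\<lambda>k. \<iota> (x k \<otimes> x k))"
  shows "weakly_mixing_to_zero x"
  unfolding weakly_mixing_to_zero_def
proof
  fix f :: "'a \<Rightarrow>\<^sub>L real"
  have \<iota>: "linear \<iota>" "\<And>u. norm (\<iota> u) = \<alpha> u" "closure (range \<iota>) = UNIV"
    using assms(4) by (auto simp: is_completion_def)
  have "linear (tensor_apply (f \<otimes> f) :: ('a, 'a) tensor \<Rightarrow> real)"
    using bilinear_tensor_apply unfolding bilinear_def by blast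
  moreover have "norm (tensor_apply (f \<otimes> f) u) \<le> conjugate_norm \<alpha> (f \<otimes> f) * norm (\<iota> u)" for u
    using conjugate_norm_bound[of \<alpha> "f \<otimes> f" u] assms(1,2) by (simp add: cross_norm_def \<iota>)
  \<comment> \<open>The norm of \<open>\<iota> u\<close> is \<open>\<alpha> u\<close>, so the
    conjugate norm of \<open>f \<otimes> f\<close> serves as the constant \<open>C\<close> of the
    extension lemma.\<close>
  ultimately obtain F :: "'z \<Rightarrow>\<^sub>L real"
    where F: "\<And>u. blinfun_apply F (\<iota> u) = tensor_apply (f \<otimes> f) u"
    using bounded_functional_extension[OF \<iota>(1) _ _ \<iota>(3)] by metis
  \<comment> \<open>On the diagonal tensors \<open>x k \<otimes> x k\<close> the functional
    \<open>F\<close> takes the values \<open>(f (x k))\<^sup>2\<close>. These are nonnegative, so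
    the absolute value outside the sum, which is all that ergodicity controls, loses
    nothing.\<close>
  have "(\<lambda>n. 1 / real n * \<bar>\<Sum>k=1..n. (blinfun_apply f (x k))\<^sup>2\<bar>) \<longlonglongrightarrow> 0"
    using assms(6)[unfolded weakly_ergodic_def, rule_format, of F]
    by (simp add: F tensor_apply_prod power2_eq_square)
  then have "(\<lambda>n. 1 / real n * (\<Sum>k=1..n. (blinfun_apply f (x k))\<^sup>2)) \<longlonglongrightarrow> 0"
    by (simp add: sum_nonneg)
  then show "(\<lambda>n. 1 / real n * (\<Sum>k=1..n. \<bar>blinfun_apply f (x k)\<bar>)) \<longlonglongrightarrow> 0"
    by (rule cesaro_abs_tendsto_zero_if_square)
qed

end
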